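(* (Saturation principle in ${}^*\mathbb{C}$.) Let $\{\mathcal{A}_n\}_{n=0}^\infty$ be a sequence of internal sets in ${}^*\mathbb{C}$ such that $\bigcap_{n=0}^m\mathcal{A}_n\neq\varnothing$ for all $m\in\mathbb{N}$. Then $\bigcap_{n=0}^\infty\mathcal{A}_n\neq\varnothing$.
   Context: Let $d\ge 1$ and $\mathcal{D}(\mathbb{R}^d)=\mathcal{C}_0^\infty(\mathbb{R}^d)$ (smooth complex-valued functions with compact support). Put $\mathcal{B}_0=\mathcal{D}(\mathbb{R}^d)$ and, for $n\in\mathbb{N}=\{1,2,\dots\}$, let $\mathcal{B}_n$ be the set of all $\varphi\in\mathcal{D}(\mathbb{R}^d)$ such that: $\varphi$ is real-valued and symmetric ($\varphi(-x)=\varphi(x)$); $\varphi(x)=0$ whenever $\|x\|\ge 1/n$; $\int\varphi=1$; $\int x^\alpha\varphi(x)\,dx=0$ for all multi-indices $\alpha\in\mathbb{N}_0^d$ with $1\le|\alpha|\le n$; and $1\le\int|\varphi|<1+\frac1n$. It is known that each $\mathcal{B}_n$ is non-empty, that $\mathcal{B}_0\supset\mathcal{B}_1\supset\mathcal{B}_2\supset\cdots$, and that $\bigcap_n\mathcal{B}_n=\varnothing$. Fix an ultrafilter $\mathcal{U}$ on the set $\mathcal{D}(\mathbb{R}^d)$ containing the filter $\{\Phi\subseteq\mathcal{D}(\mathbb{R}^d): \mathcal{B}_n\subseteq\Phi\text{ for some }n\in\mathbb{N}\}$. ${}^*\mathbb{C}$ is the quotient of $\mathbb{C}^{\mathcal{D}(\mathbb{R}^d)}$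 (families $(A_\varphi)_{\varphi\in\mathcal{D}(\mathbb{R}^d)}$ of complex numbers) by the relation $(A_\varphi)\sim(B_\varphi)$ iff $\{\varphi: A_\varphi=B_\varphi\}\in\mathcal{U}$; the class of $(A_\varphi)$ is $\langle A_\varphi\rangle$. A property holds "a.e." if the set of $\varphi$ for which it holds belongs to $\mathcal{U}$. A subset of ${}^*\mathbb{C}$ is internal if it is of the form $\langle\mathbb{A}_\varphi\rangle=\{\langle A_\varphi\rangle\in{}^*\mathbb{C}: A_\varphi\in\mathbb{A}_\varphi\text{ a.e.}\}$ for some family $(\mathbb{A}_\varphi)_{\varphi\in\mathcal{D}(\mathbb{R}^d)}$ of subsets of $\mathbb{C}$. *)

theory Defs
  imports "HOL-Analysis.Analysis"
begin

text \<open>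
  \<open>C_times k f\<close>: the function \<open>f\<close> is of class \<open>C\<close>-\<open>k\<close>. For a finite-dimensional domain this is
  the usual notion: \<open>f\<close> is \<open>C\<close>-\<open>(k + 1)\<close> iff it is differentiable everywhere and all its
  directional derivatives are \<open>C\<close>-\<open>k\<close>.
\<close>

primrec C_times :: "nat \<Rightarrow> ('a::real_normed_vector \<Rightarrow> 'b::real_normed_vector) \<Rightarrow> bool" where
  "C_times 0 f \<longleftrightarrow> continuous_on UNIV f"
| "C_times (Suc k) f \<longleftrightarrow> (\<forall>x. f differentiable at x) \<and>
     (\<forall>v. C_times k (\<lambda>x. frechet_derivative f (at x) v))"

definition smooth :: "('a::real_normed_vector \<Rightarrow> 'b::real_normed_vector) \<Rightarrow> bool" where
  "smooth f \<longleftrightarrow> (\<forall>k. C_times k f)"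

lemma C_times_zero: "C_times k (\<lambda>_. 0)"
  by (induction k) (simp_all add: frechet_derivative_const)

text \<open>
  The space of test functions on \<open>\<real>\<^sup>d\<close>, where \<open>d = CARD('d)\<close>.
\<close>

typedef (overloaded) ('d::finite) test_fun =
  "{f :: real ^ 'd \<Rightarrow> complex. smooth f \<and> compact (closure {x. f x \<noteq> 0})}"
  morphisms test_app Abs_test_fun
proof
  show "(\<lambda>_. 0) \<in> {f :: real ^ 'd \<Rightarrow> complex. smooth f \<and> compact (closure {x. f x \<noteq> 0})}"
    by (simp add: smooth_def C_times_zero)
qed

definition monomial :: "('d::finite \<Rightarrow> nat) \<Rightarrow> real ^ 'd \<Rightarrow> real" where
  "monomial \<alpha> x = (\<Prod>i\<in>UNIV. (x $ i) ^ \<alpha> i)"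

definition B :: "nat \<Rightarrow> ('d::finite) test_fun set" where
  "B n = (if n = 0 then UNIV else {\<phi>.
     (\<forall>x. test_app \<phi> x \<in> \<real>) \<and>
     (\<forall>x. test_app \<phi> (- x) = test_app \<phi> x) \<and>
     (\<forall>x. norm x \<ge> 1 / real n \<longrightarrow> test_app \<phi> x = 0) \<and>
     (LINT x|lborel. test_app \<phi> x) = 1 \<and>
     (\<forall>\<alpha>. 1 \<le> (\<Sum>i\<in>UNIV. \<alpha> i) \<and> (\<Sum>i\<in>UNIV. \<alpha> i) \<le> n \<longrightarrow>
        (LINT x|lborel. complex_of_real (monomial \<alpha> x) * test_app \<phi> x) = 0) \<and>
     1 \<le> (LINT x|lborel. norm (test_app \<phi> x)) \<and>
     (LINT x|lborel. norm (test_app \<phi> x)) < 1 + 1 / real n})"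

text \<open>
  A set \<open>S\<close> is a member of the filter \<open>F\<close> iff \<open>eventually (\<lambda>x. x \<in> S) F\<close>, so that ``a.e.'' is
  \<open>\<forall>\<^sub>F \<phi> in U. \<dots>\<close>; HOL filters may be improper, hence the first conjunct.
\<close>

definition ultrafilter :: "'a filter \<Rightarrow> bool" where
  "ultrafilter F \<longleftrightarrow> F \<noteq> bot \<and> (\<forall>P. eventually P F \<or> eventually (\<lambda>x. \<not> P x) F)"

definition star_rel ::
  "('d::finite) test_fun filter \<Rightarrow> (('d test_fun \<Rightarrow> complex) \<times> ('d test_fun \<Rightarrow> complex)) set" where
  "star_rel U = {(A, A'). \<forall>\<^sub>F \<phi> in U. A \<phi> = A' \<phi>}"

text \<open>
  The field of nonstandard complex numbers depends on \<open>U\<close>, so it is a set of equivalence classes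
  rather than a type.
\<close>

definition star_complex :: "('d::finite) test_fun filter \<Rightarrow> ('d test_fun \<Rightarrow> complex) set set" where
  "star_complex U = UNIV // star_rel U"

definition star_class ::
  "('d::finite) test_fun filter \<Rightarrow> ('d test_fun \<Rightarrow> complex) \<Rightarrow> ('d test_fun \<Rightarrow> complex) set" where
  "star_class U A = star_rel U `` {A}"

lemma equiv_star_rel: "equiv UNIV (star_rel U)"
proof (rule equivI)
  show "refl (star_rel U)"
    by (simp add: refl_on_def star_rel_def)
  show "sym (star_rel U)"
    by (auto simp: sym_def star_rel_def elim: eventually_mono)
  show "trans (star_rel U)"
    by (auto simp: trans_def star_rel_def elim: eventually_elim2)
qed simp

lemma star_class_eq_iff: "star_class U A = star_class U A' \<longleftrightarrow> (\<forall>\<^sub>F \<phi> in U. A \<phi> = A' \<phi>)"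
  unfolding star_class_def
  by (subst eq_equiv_class_iff[OF equiv_star_rel]) (simp_all add: star_rel_def)

lemma star_class_in_star_complex: "star_class U A \<in> star_complex U"
  by (simp add: star_class_def star_complex_def quotientI)

definition internal_of ::
  "('d::finite) test_fun filter \<Rightarrow> ('d test_fun \<Rightarrow> complex set) \<Rightarrow> ('d test_fun \<Rightarrow> complex) set set" where
  "internal_of U AA = {a \<in> star_complex U. \<exists>A. a = star_class U A \<and> (\<forall>\<^sub>F \<phi> in U. A \<phi> \<in> AA \<phi>)}"

definition internal :: "('d::finite) test_fun filter \<Rightarrow> ('d test_fun \<Rightarrow> complex) set set \<Rightarrow> bool" where
  "internal U S \<longleftrightarrow> (\<exists>AA. S = internal_of U AA)"

end

theory Submission
  imports Defs
begin

text \<open>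
  The theorem rests on one property of the filter: there are countably many sets, each belonging to
  it, whose intersection is empty. The sets \<open>B n\<close> with \<open>n \<ge> 1\<close> form such a family, because a
  function in all of them vanishes away from the origin and hence cannot have integral \<open>1\<close>
  (\<open>INT_B_Suc_eq_empty\<close>).

  Write \<open>\<A> n = \<langle>AA n \<phi>\<rangle>\<close>. Non-emptiness of the \<open>m\<close>-th finite intersection of internal sets means
  that \<open>\<Inter>n\<le>m. AA n \<phi>\<close> is non-empty for almost every \<open>\<phi>\<close>
  (\<open>eventually_INT_nonempty_if_INT_internal_nonempty\<close>). For a single \<open>\<phi>\<close> every finite stage may be
  non-empty although no point lies in all \<open>AA n \<phi>\<close>. But since \<open>\<phi>\<close> lies in only finitely many of the
  initial intersections of the \<open>B n\<close>, the number of stages to be respected at \<open>\<phi>\<close> can be cut off at a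
  finite value depending on \<open>\<phi>\<close>, and one point of the corresponding finite intersection is chosen
  there. Any fixed stage \<open>m\<close> is below the cut-off almost everywhere, so the class of the chosen
  family lies in every \<open>\<A> m\<close> (\<open>countable_saturation_filter\<close>).
\<close>

text \<open>
  The sets \<open>D k\<close> make the diagonal argument finite: every \<open>x\<close> is outside some \<open>D k\<close>, so only
  finitely many stages have to be met at \<open>x\<close>, and a point that meets the last of them meets all.
\<close>

lemma countable_saturation_filter:
  fixes D :: "nat \<Rightarrow> 'a set" and S :: "nat \<Rightarrow> 'a \<Rightarrow> 'b set"
  assumes D: "\<And>n. \<forall>\<^sub>F x in F. x \<in> D n"
    and D_empty: "(\<Inter>n. D n) = {}"
    and S: "\<And>m. \<forall>\<^sub>F x in F. (\<Inter>n\<le>m. S n x) \<noteq> {}"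
  shows "\<exists>f. \<forall>n. \<forall>\<^sub>F x in F. f x \<in> S n x"
proof -
  define good where "good x m \<longleftrightarrow> (\<forall>k\<le>m. x \<in> D k) \<and> (\<Inter>n\<le>m. S n x) \<noteq> {}" for x m
  have "\<exists>z. \<forall>m. good x m \<longrightarrow> z \<in> S m x" for x
  proof (cases "{m. good x m} = {}")
    case False
    obtain k where k: "x \<notin> D k"
      using D_empty by blast
    have "{m. good x m} \<subseteq> {..<k}"
      using k by (auto simp: good_def not_le[symmetric])
    then have fin: "finite {m. good x m}"
      by (rule finite_subset) simp
    define M where "M = Max {m. good x m}"
    have "good x M"
      using Max_in[OF fin False] by (simp add: M_def)
    then obtain z where z: "\<forall>n\<le>M. z \<in> S n x"
      by (auto simp: good_def)
    have "m \<le> M" if "good x m" for m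
      unfolding M_def using fin that by (intro Max_ge) auto
    with z show ?thesis
      by blast
  qed auto
  then obtain f where f: "\<And>x m. good x m \<Longrightarrow> f x \<in> S m x"
    by metis
  have "\<forall>\<^sub>F x in F. f x \<in> S m x" for m
  proof -
    have "\<forall>\<^sub>F x in F. \<forall>k\<in>{..m}. x \<in> D k"
      using D by (intro eventually_ball_finite) auto
    with S[of m] have "\<forall>\<^sub>F x in F. good x m"
      by eventually_elim (auto simp: good_def)
    then show ?thesis
      by eventually_elim (rule f)
  qed
  then show ?thesis
    by blast
qed

lemma INT_B_Suc_eq_empty: "(\<Inter>n. B (Suc n)) = ({} :: ('d::finite) test_fun set)"
proof -
  have False if \<phi>: "\<And>n. \<phi> \<in> B (Suc n)" for \<phi> :: "'d test_fun"
  proof -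
    have zero: "test_app \<phi> x = 0" if nz: "x \<noteq> 0" for x
    proof -
      obtain n where "inverse (real (Suc n)) < norm x"
        using reals_Archimedean[of "norm x"] nz by (meson zero_less_norm_iff)
      then have "norm x \<ge> 1 / real (Suc n)"
        by (simp add: inverse_eq_divide)
      then show ?thesis
        using \<phi>[of n] by (auto simp: B_def)
    qed
    have "AE x in lborel. test_app \<phi> x = 0"
      using AE_lborel_singleton[of 0] by eventually_elim (rule zero)
    then have "(LINT x|lborel. test_app \<phi> x) = 0"
      by (rule integral_eq_zero_AE)
    then show False
      using \<phi>[of 0] by (simp add: B_def)
  qed
  then show ?thesis
    by blast
qed

text \<open>
  An element of \<open>internal_of U AA\<close> is only required to have some representative with values in \<open>AA\<close>.
  Since two representatives agree almost everywhere, every representative has this property,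
  which allows a single one to serve for several internal sets at once.
\<close>

lemma star_class_in_internal_of_iff:
  "star_class U A \<in> internal_of U AA \<longleftrightarrow> (\<forall>\<^sub>F \<phi> in U. A \<phi> \<in> AA \<phi>)"
proof
  assume "star_class U A \<in> internal_of U AA"
  then obtain A' where "\<forall>\<^sub>F \<phi> in U. A \<phi> = A' \<phi>" "\<forall>\<^sub>F \<phi> in U. A' \<phi> \<in> AA \<phi>"
    by (auto simp: internal_of_def star_class_eq_iff)
  then show "\<forall>\<^sub>F \<phi> in U. A \<phi> \<in> AA \<phi>"
    by eventually_elim simp
qed (auto simp: internal_of_def star_class_in_star_complex)

lemma eventually_INT_nonempty_if_INT_internal_nonempty:
  assumes "finite I" and "I \<noteq> {}" and "(\<Inter>n\<in>I. internal_of U (AA n)) \<noteq> {}"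
  shows "\<forall>\<^sub>F \<phi> in U. (\<Inter>n\<in>I. AA n \<phi>) \<noteq> {}"
proof -
  obtain a where a: "\<forall>n\<in>I. a \<in> internal_of U (AA n)"
    using assms(3) by blast
  with \<open>I \<noteq> {}\<close> obtain A where "a = star_class U A"
    by (auto simp: internal_of_def)
  with a have "\<forall>n\<in>I. \<forall>\<^sub>F \<phi> in U. A \<phi> \<in> AA n \<phi>"
    by (simp add: star_class_in_internal_of_iff)
  with \<open>finite I\<close> have "\<forall>\<^sub>F \<phi> in U. \<forall>n\<in>I. A \<phi> \<in> AA n \<phi>"
    by (rule eventually_ball_finite)
  then show ?thesis
    by eventually_elim auto
qed

theorem theorem7p1:
  fixes U :: "('d::finite) test_fun filter"
    and \<A> :: "nat \<Rightarrow> ('d test_fun \<Rightarrow> complex) set set"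
  assumes ultra: "ultrafilter U"
    and base: "\<And>\<Phi>. (\<exists>n\<ge>1. B n \<subseteq> \<Phi>) \<Longrightarrow> (\<forall>\<^sub>F \<phi> in U. \<phi> \<in> \<Phi>)"
    and internal: "\<And>n. internal U (\<A> n)"
    and fip: "\<And>m. m \<ge> 1 \<Longrightarrow> (\<Inter>n\<in>{0..m}. \<A> n) \<noteq> {}"
  shows "(\<Inter>n. \<A> n) \<noteq> {}"
proof -
  obtain AA where AA: "\<And>n. \<A> n = internal_of U (AA n)"
    using internal unfolding internal_def by metis
  have "\<forall>\<^sub>F \<phi> in U. \<phi> \<in> B (Suc n)" for n
    by (rule base) (auto intro: exI[of _ "Suc n"])
  moreover have "\<forall>\<^sub>F \<phi> in U. (\<Inter>n\<le>m. AA n \<phi>) \<noteq> {}" for m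
  proof (rule eventually_INT_nonempty_if_INT_internal_nonempty)
    \<comment> \<open>The hypothesis starts at \<open>m = 1\<close>; stage \<open>Suc m\<close> covers \<open>m = 0\<close> as well.\<close>
    have "(\<Inter>n\<in>{0..Suc m}. \<A> n) \<subseteq> (\<Inter>n\<le>m. \<A> n)"
      by (intro INF_superset_mono) auto
    then show "(\<Inter>n\<le>m. internal_of U (AA n)) \<noteq> {}"
      using fip[of "Suc m"] by (auto simp: AA)
  qed auto
  ultimately obtain A where "\<And>n. \<forall>\<^sub>F \<phi> in U. A \<phi> \<in> AA n \<phi>"
    using countable_saturation_filter[where F = U and D = "\<lambda>n. B (Suc n)" and S = AA]
      INT_B_Suc_eq_empty by blast
  then have "star_class U A \<in> (\<Inter>n. \<A> n)"
    by (simp add: AA star_class_in_internal_of_iff)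
  then show ?thesis
    by blast
qed

end
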